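(* Let $a\ge1$, $n\ge1$, $b\ge3$ be integers and let $$P_{a,b,n}(z):=(1+z)^a+\bigl(1+2bz+b(b-1)z^2\bigr)^n-1=\sum_{k=0}^{D}p_kz^k,$$ where $D=\max\{a,2n\}$ and, with the conventions $\binom{a}{k}=0$ for $k<0$ or $k>a$ and $q_k=0$ for $k<0$ or $k>2n$, $p_0=1$ and $p_k=\binom{a}{k}+q_k$ for $k\ge1$, with $$q_k=\sum_{j=0}^{\lfloor k/2\rfloor}\binom{n}{j}\binom{n-j}{k-2j}(2b)^{k-2j}\bigl(b(b-1)\bigr)^j .$$ Then the following hold. (i) $P_{a,b,n}(z)$ is log-concave if and only if $p_k^2\ge p_{k-1}p_{k+1}$ for every $1\le k\le s$, where $s=\min\{D-1,\ \min\{a,2n\}+1\}$. Equivalently, $$\left(\binom{a}{k}+q_k\right)^2\ge\left(\binom{a}{k-1}+q_{k-1}\right)\left(\binom{a}{k+1}+q_{k+1}\right)\qquad(1\le k\le s),$$ where for $k=1$ the factor $\binom{a}{0}+q_0$ is to be read as $p_0=1$. (ii) $P_{a,b,n}(z)$ is unimodal if and only if there exists an index $t\in\{0,1,\dots,D\}$ such that $p_0\le p_1\le\cdots\le p_t\ge p_{t+1}\ge\cdots\ge p_D$. Equivalently, if $\nabla_k:=p_k-p_{k-1}$ for $1\le k\le D$, then $P_{a,b,n}(z)$ is unimodal if and only if the sequence $(\nabla_k)_{k=1}^{D}$ has at most one sign change, and that sign change (if it occurs) is from $+$ to $-$. In particular, whenever the inequalities in part (i) hold, the polynomial $P_{a,b,n}(z)$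 is unimodal.
   Context: A polynomial $\sum_{k=0}^D p_kz^k$ with positive coefficients is called log-concave if $p_k^2\ge p_{k-1}p_{k+1}$ for all $1\le k\le D-1$, and unimodal if its coefficient sequence weakly increases up to some index and weakly decreases afterwards. Sign changes of a real sequence are counted after discarding zero terms. $P_{a,b,n}(z)$ is the independence polynomial of the graph $\overline{K}_a\nabla(nB_b)$, the join of an edgeless graph on $a$ vertices with $n$ disjoint copies of the graph $B_b$ consisting of two copies of $K_b$ joined by a perfect matching; this is not needed for the statement. *)

theory Defs
  imports "HOL-Computational_Algebra.Polynomial"
begin

definition pos_coeffs :: "real poly \<Rightarrow> bool" where
  "pos_coeffs f \<longleftrightarrow> (\<forall>k\<le>degree f. coeff f k > 0)"

text \<open>Log-concavity and unimodality are notions for polynomials with positive coefficients,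
  so both predicates include positivity.\<close>

definition log_concave :: "real poly \<Rightarrow> bool" where
  "log_concave f \<longleftrightarrow> pos_coeffs f \<and>
     (\<forall>k. 1 \<le> k \<and> k < degree f \<longrightarrow> (coeff f k)\<^sup>2 \<ge> coeff f (k - 1) * coeff f (k + 1))"

definition unimodal :: "real poly \<Rightarrow> bool" where
  "unimodal f \<longleftrightarrow> pos_coeffs f \<and>
     (\<exists>t\<le>degree f. mono_on {..t} (coeff f) \<and> antimono_on {t..degree f} (coeff f))"

text \<open>The sign changes of a finite real sequence, as the list of pairs of consecutive terms of
  opposite sign that remain after the zero terms have been discarded. The number of sign changes
  is the length of this list.\<close>

definition sign_changes :: "real list \<Rightarrow> (real \<times> real) list" where
  "sign_changes xs =
     (let ys = filter (\<lambda>x. x \<noteq> 0) xs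
      in filter (\<lambda>(x, y). sgn x \<noteq> sgn y) (zip ys (tl ys)))"

definition P :: "nat \<Rightarrow> nat \<Rightarrow> nat \<Rightarrow> real poly" where
  "P a b n = [:1, 1:] ^ a + [:1, 2 * real b, real b * (real b - 1):] ^ n - 1"

text \<open>For \<open>k > 2 * n\<close> every summand vanishes, so the convention \<open>q b n k = 0\<close> there needs no
  separate case. Truncated subtraction is harmless: \<open>2 * j \<le> k\<close> in the range of summation,
  and \<open>n choose j = 0\<close> when \<open>j > n\<close>.\<close>

definition q :: "nat \<Rightarrow> nat \<Rightarrow> nat \<Rightarrow> real" where
  "q b n k = (\<Sum>j=0..k div 2. real (n choose j) * real ((n - j) choose (k - 2 * j)) *
                (2 * real b) ^ (k - 2 * j) * (real b * (real b - 1)) ^ j)"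

definition p :: "nat \<Rightarrow> nat \<Rightarrow> nat \<Rightarrow> nat \<Rightarrow> real" where
  "p a b n k = (if k = 0 then 1 else real (a choose k) + q b n k)"

end

theory Submission
  imports Defs
begin

text \<open>Both \<open>(1 + z)\<^sup>a\<close> and \<open>(1 + 2bz + b(b - 1)z\<^sup>2)\<^sup>n\<close> are products of real linear factors
  \<open>1 + rz\<close> with \<open>r \<ge> 0\<close> (in the quadratic, \<open>r = b \<plusminus> \<surd>b\<close>), and multiplication by such a factor
  preserves log-concavity. From index \<open>min a (2 * n) + 1\<close> on only one of the two summands
  contributes to \<open>p\<close>, so the log-concavity inequalities beyond \<open>s\<close> hold automatically.\<close>

section \<open>Strong log-concavity under multiplication by linear factors\<close>

text \<open>Coefficients are indexed by \<open>int\<close> so that \<open>c\<^sub>k\<^sub>-\<^sub>1\<close> is \<open>0\<close>, not \<open>c\<^sub>0\<close>, at \<open>k = 0\<close>.\<close>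

definition icoeff :: "real poly \<Rightarrow> int \<Rightarrow> real" where
  "icoeff f k = (if k < 0 then 0 else coeff f (nat k))"

text \<open>The inequality at \<open>i = j\<close> alone would allow internal zeros and is not preserved by
  multiplication with a linear factor.\<close>

definition strongly_log_concave :: "real poly \<Rightarrow> bool" where
  "strongly_log_concave f \<longleftrightarrow>
     (\<forall>k. coeff f k \<ge> 0) \<and>
     (\<forall>i j. i \<le> j \<longrightarrow> icoeff f (i - 1) * icoeff f (j + 1) \<le> icoeff f i * icoeff f j)"

lemma icoeff_mult_linear:
  "icoeff ([:1, r:] * f) k = icoeff f k + r * icoeff f (k - 1)"
proof (cases "k \<le> 0")
  case False
  then have "nat k = Suc (nat (k - 1))" by simp
  with False show ?thesis
    by (simp add: icoeff_def)
qed (auto simp: icoeff_def)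

lemma strongly_log_concave_1: "strongly_log_concave 1"
  by (auto simp: strongly_log_concave_def icoeff_def coeff_1)

text \<open>Both sides are polynomials in \<open>r\<close> of degree 2. The product
  \<open>c (i - 1) * c j\<close> occurs in both coefficients of \<open>r\<close> and cancels; what
  remains is compared power by power.\<close>

lemma strongly_log_concave_mult_linear:
  assumes f: "strongly_log_concave f" and r: "r \<ge> 0"
  shows "strongly_log_concave ([:1, r:] * f)"
  unfolding strongly_log_concave_def
proof (intro conjI allI impI)
  fix k show "coeff ([:1, r:] * f) k \<ge> 0"
    using f r by (cases k) (auto simp: strongly_log_concave_def)
next
  fix i j :: int assume ij: "i \<le> j"
  define c where "c = icoeff f"
  have lc: "c (i - 1) * c (j + 1) \<le> c i * c j" if "i \<le> j" for i j
    using f that by (auto simp: strongly_log_concave_def c_def)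
  have 1: "c (i - 1) * c (j + 1) \<le> c i * c j"
    using lc ij by blast
  \<comment> \<open>The indices move inwards twice, with \<open>c (i - 1) * c j\<close> in between.
    For \<open>i = j\<close> this middle product is already the target, and the second move would
    need \<open>i \<le> j - 1\<close>.\<close>
  have 2: "c (i - 2) * c (j + 1) \<le> c i * c (j - 1)"
  proof (cases "i = j")
    case True
    then show ?thesis using lc[of "i - 1" j] by (simp add: mult.commute)
  next
    case False
    have "c (i - 2) * c (j + 1) \<le> c (i - 1) * c j"
      using lc[of "i - 1" j] ij by simp
    also have "\<dots> \<le> c i * c (j - 1)"
      using lc[of i "j - 1"] ij False by simp
    finally show ?thesis .
  qed
  have 3: "c (i - 2) * c j \<le> c (i - 1) * c (j - 1)"
    using lc[of "i - 1" "j - 1"] ij by simp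
  have "r * (c (i - 2) * c (j + 1)) \<le> r * (c i * c (j - 1))"
    "r\<^sup>2 * (c (i - 2) * c j) \<le> r\<^sup>2 * (c (i - 1) * c (j - 1))"
    using 2 3 r by (auto intro: mult_left_mono)
  with 1 show "icoeff ([:1, r:] * f) (i - 1) * icoeff ([:1, r:] * f) (j + 1)
      \<le> icoeff ([:1, r:] * f) i * icoeff ([:1, r:] * f) j"
    unfolding icoeff_mult_linear c_def
    by (simp add: algebra_simps power2_eq_square)
qed

lemma strongly_log_concave_linear_power:
  assumes "r \<ge> 0"
  shows "strongly_log_concave ([:1, r:] ^ n)"
  by (induction n)
     (use strongly_log_concave_1 strongly_log_concave_mult_linear[OF _ assms] in auto)

lemma strongly_log_concave_quadratic_power:
  assumes "r \<ge> 0" "t \<ge> 0"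
  shows "strongly_log_concave ([:1, r + t, r * t:] ^ n)"
proof (induction n)
  case 0
  then show ?case using strongly_log_concave_1 by simp
next
  case (Suc n)
  have "[:1, r + t, r * t:] ^ Suc n = [:1, r:] * ([:1, t:] * [:1, r + t, r * t:] ^ n)"
    by (simp add: algebra_simps smult_add_left smult_add_right)
  then show ?case
    using Suc assms by (simp only: strongly_log_concave_mult_linear)
qed

lemma strongly_log_concave_coeff:
  assumes "strongly_log_concave f" "k \<ge> 1"
  shows "coeff f (k - 1) * coeff f (k + 1) \<le> (coeff f k)\<^sup>2"
proof -
  have "icoeff f (int k - 1) * icoeff f (int k + 1) \<le> icoeff f (int k) * icoeff f (int k)"
    using assms by (auto simp: strongly_log_concave_def)
  moreover have "nat (int k - 1) = k - 1" "nat (int k + 1) = k + 1" by auto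
  ultimately show ?thesis using assms(2)
    by (simp add: icoeff_def power2_eq_square)
qed

section \<open>Coefficients of the two powers and of \<open>P\<close>: expansion, log-concavity,
  positivity\<close>

lemma coeff_one_plus_power:
  "coeff ([:1, c:] ^ m) k = real (m choose k) * c ^ k"
proof (induction m arbitrary: k)
  case 0
  then show ?case by (cases k) auto
next
  case (Suc m)
  then show ?case by (cases k) (auto simp: algebra_simps)
qed

text \<open>Binomial expansion of \<open>C * z^2 + (1 + B * z)\<close>: in the summand for
  \<open>j\<close>, exactly \<open>j\<close> factors supply \<open>C * z^2\<close>, and the power of
  the linear polynomial supplies the remaining degree \<open>k - 2 * j\<close>.\<close>

lemma coeff_quadratic_power:
  "coeff ([:1, 2 * real b, real b * (real b - 1):] ^ n) k = q b n k"
proof -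
  define B C where "B = 2 * real b" and "C = real b * (real b - 1)"
  define g where "g j = real (n choose j) * real ((n - j) choose (k - 2 * j)) * B ^ (k - 2 * j) * C ^ j" for j
  have "[:1, B, C:] = monom C 2 + [:1, B:]"
    by (simp add: monom_altdef power2_eq_square)
  then have "[:1, B, C:] ^ n = (\<Sum>j\<le>n. of_nat (n choose j) * monom C 2 ^ j * [:1, B:] ^ (n - j))"
    by (simp add: binomial_ring)
  also have "\<dots> = (\<Sum>j\<le>n. smult (real (n choose j)) (monom (C ^ j) (2 * j) * [:1, B:] ^ (n - j)))"
    by (simp add: monom_power of_nat_poly mult.assoc mult.commute)
  finally have "coeff ([:1, B, C:] ^ n) k = (\<Sum>j\<le>n. if 2 * j \<le> k then g j else 0)"
    by (simp add: coeff_sum coeff_monom_mult coeff_one_plus_power g_def if_distrib ac_simps cong: if_cong)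
       (intro sum.cong, auto)
  also have "\<dots> = (\<Sum>j\<in>{..n} \<inter> {..k div 2}. g j)"
    by (subst sum.inter_restrict) (auto intro!: sum.cong)
  also have "\<dots> = (\<Sum>j=0..k div 2. g j)"
    by (intro sum.mono_neutral_left) (auto simp: g_def)
  finally show ?thesis by (simp add: q_def g_def B_def C_def)
qed

lemma q_log_concave:
  assumes "k \<ge> 1"
  shows "q b n (k - 1) * q b n (k + 1) \<le> (q b n k)\<^sup>2"
proof -
  \<comment> \<open>Leads to \<open>real b - sqrt b \<ge> 0\<close>, the sign condition on the
    smaller linear factor.\<close>
  have "real b \<le> real (b\<^sup>2)"
    by (subst of_nat_le_iff) (simp add: power2_eq_square)
  then have "sqrt (real b) \<le> real b" by (intro real_le_lsqrt) auto
  then have "strongly_log_concave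
    ([:1, (real b + sqrt b) + (real b - sqrt b), (real b + sqrt b) * (real b - sqrt b):] ^ n)"
    by (intro strongly_log_concave_quadratic_power) auto
  also have "(real b + sqrt b) * (real b - sqrt b) = real b * (real b - 1)"
    by (simp add: algebra_simps)
  finally show ?thesis
    using strongly_log_concave_coeff[OF _ assms] by (simp flip: coeff_quadratic_power)
qed

lemma choose_log_concave:
  assumes "k \<ge> 1"
  shows "real (a choose (k - 1)) * real (a choose (k + 1)) \<le> (real (a choose k))\<^sup>2"
  using strongly_log_concave_coeff[OF strongly_log_concave_linear_power[of 1 a] assms]
  by (simp add: coeff_one_plus_power)

lemma q_nonneg:
  assumes "b \<ge> 1"
  shows "q b n k \<ge> 0"
  unfolding q_def using assms by (intro sum_nonneg mult_nonneg_nonneg) auto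

lemma q_pos:
  assumes "b \<ge> 2" "k \<le> 2 * n"
  shows "q b n k > 0"
  unfolding q_def
\<comment> \<open>The subtraction is truncated: for \<open>k \<le> n\<close> the witness is 0 and
  the factor \<open>n choose k\<close> is positive; for \<open>k > n\<close> it is the least
  \<open>j\<close> with \<open>k - 2 * j \<le> n - j\<close>.\<close>
proof (rule sum_pos2[where i = "k - n"])
  show "0 < real (n choose (k - n)) * real ((n - (k - n)) choose (k - 2 * (k - n))) *
          (2 * real b) ^ (k - 2 * (k - n)) * (real b * (real b - 1)) ^ (k - n)"
    using assms by (intro mult_pos_pos zero_less_power) auto
qed (use assms in \<open>auto intro!: mult_nonneg_nonneg\<close>)

lemma q_eq_0:
  assumes "k > 2 * n"
  shows "q b n k = 0"
  unfolding q_def by (rule sum.neutral) (use assms in \<open>auto simp: binomial_eq_0_iff\<close>)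

lemma q_0: "q b n 0 = 1"
  by (simp add: q_def)

text \<open>Each power has constant term 1 and the \<open>- 1\<close> removes one of them, hence the
  separate value of \<open>p\<close> at 0.\<close>

lemma coeff_P: "coeff (P a b n) k = p a b n k"
  by (simp add: P_def p_def coeff_quadratic_power coeff_one_plus_power q_0 coeff_1)

lemma p_pos:
  assumes "b \<ge> 2" "k \<le> max a (2 * n)"
  shows "p a b n k > 0"
proof (cases "k \<le> 2 * n")
  case True
  then show ?thesis using q_pos[OF assms(1) True] by (simp add: p_def add_nonneg_pos)
next
  case False
  then show ?thesis using assms q_nonneg[of b n k] by (auto simp: p_def add_pos_nonneg)
qed

lemma p_eq_0:
  assumes "k > max a (2 * n)"
  shows "p a b n k = 0"
  using assms by (simp add: p_def q_eq_0)

text \<open>The offset 2 puts even \<open>k - 1\<close> above \<open>min a (2 * n)\<close>, so at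
  all three indices \<open>p\<close> equals the same single summand, a binomial coefficient or
  \<open>q\<close>. Since \<open>k - 1 > 0\<close>, the special value of \<open>p\<close> at 0 does
  not enter.\<close>

lemma p_log_concave_beyond:
  assumes "k \<ge> min a (2 * n) + 2"
  shows "p a b n (k - 1) * p a b n (k + 1) \<le> (p a b n k)\<^sup>2"
proof (cases "a \<le> 2 * n")
  case True
  then show ?thesis using assms q_log_concave[of k b n] by (simp add: p_def binomial_eq_0)
next
  case False
  then show ?thesis using assms choose_log_concave[of k a] by (simp add: p_def q_eq_0)
qed

lemma degree_P:
  assumes "b \<ge> 2"
  shows "degree (P a b n) = max a (2 * n)"
proof (rule antisym)
  show "degree (P a b n) \<le> max a (2 * n)"
    by (intro degree_le) (auto simp: coeff_P p_eq_0)
  show "max a (2 * n) \<le> degree (P a b n)"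
    using p_pos[OF assms, of "max a (2 * n)" a n] by (intro le_degree) (simp add: coeff_P)
qed

section \<open>Unimodality through steps between neighbouring coefficients\<close>

lemma mono_on_atMost_iff:
  fixes f :: "nat \<Rightarrow> 'a :: preorder"
  shows "mono_on {..t} f \<longleftrightarrow> (\<forall>k\<in>{1..t}. f (k - 1) \<le> f k)"
proof
  assume step: "\<forall>k\<in>{1..t}. f (k - 1) \<le> f k"
  show "mono_on {..t} f"
  proof (rule mono_onI)
    fix r s assume "r \<in> {..t}" "s \<in> {..t}" "r \<le> s"
    from \<open>r \<le> s\<close> \<open>s \<in> {..t}\<close> show "f r \<le> f s"
    proof (induction rule: dec_induct)
      case (step s)
      then show ?case
        using \<open>\<forall>k\<in>{1..t}. f (k - 1) \<le> f k\<close>[rule_format, of "Suc s"] by (auto intro: order_trans)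
    qed simp
  qed
qed (auto simp: mono_on_def)

lemma antimono_on_atLeastAtMost_iff:
  fixes f :: "nat \<Rightarrow> 'a :: preorder"
  shows "antimono_on {t..m} f \<longleftrightarrow> (\<forall>k\<in>{t+1..m}. f k \<le> f (k - 1))"
proof
  assume step: "\<forall>k\<in>{t+1..m}. f k \<le> f (k - 1)"
  show "antimono_on {t..m} f"
  proof (rule monotone_onI)
    fix r s assume "r \<in> {t..m}" "s \<in> {t..m}" "r \<le> s"
    from \<open>r \<le> s\<close> \<open>s \<in> {t..m}\<close> show "f s \<le> f r"
    proof (induction rule: dec_induct)
      case (step s)
      then show ?case
        using \<open>\<forall>k\<in>{t+1..m}. f k \<le> f (k - 1)\<close>[rule_format, of "Suc s"] \<open>r \<in> {t..m}\<close>
        by (auto intro: order_trans)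
    qed simp
  qed
next
  assume "antimono_on {t..m} f"
  moreover have "k - 1 \<in> {t..m} \<and> k \<in> {t..m} \<and> k - 1 \<le> k" if "k \<in> {t+1..m}" for k
    using that by auto
  ultimately show "\<forall>k\<in>{t+1..m}. f k \<le> f (k - 1)"
    unfolding monotone_on_def by blast
qed

lemma unimodal_iff:
  "unimodal f \<longleftrightarrow> pos_coeffs f \<and>
     (\<exists>t\<in>{0..degree f}. (\<forall>k\<in>{1..t}. coeff f (k - 1) \<le> coeff f k) \<and>
                      (\<forall>k\<in>{t+1..degree f}. coeff f (k - 1) \<ge> coeff f k))"
  unfolding unimodal_def mono_on_atMost_iff antimono_on_atLeastAtMost_iff by auto

text \<open>For positive coefficients, log-concavity says that successive ratios do not increase;
  after the first strict descent no ratio can exceed 1 again.\<close>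

lemma log_concave_imp_unimodal:
  assumes "log_concave f"
  shows "unimodal f"
proof -
  define d where "d = degree f"
  define c where "c = coeff f"
  have pos: "c k > 0" if "k \<le> d" for k
    using assms that by (auto simp: log_concave_def pos_coeffs_def c_def d_def)
  have lc: "c (k - 1) * c (k + 1) \<le> (c k)\<^sup>2" if "1 \<le> k" "k < d" for k
    using assms that by (auto simp: log_concave_def c_def d_def)
  \<comment> \<open>The disjunct \<open>t = d\<close> guarantees existence when the coefficients
    never drop; minimality makes every step before \<open>t\<close> weakly increasing.\<close>
  define t where "t = (LEAST t. t = d \<or> c (Suc t) < c t)"
  have t: "t = d \<or> c (Suc t) < c t"
    unfolding t_def by (rule LeastI[of _ d]) simp
  have td: "t \<le> d"
    unfolding t_def by (rule Least_le) simp
  have up: "c (k - 1) \<le> c k" if "k \<in> {1..t}" for k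
    using not_less_Least[of "k - 1" "\<lambda>t. t = d \<or> c (Suc t) < c t"] that
    by (fastforce simp flip: t_def)
  have down: "c (Suc k) \<le> c k" if "t \<le> k" "Suc k \<le> d" for k
    using that
  proof (induction rule: dec_induct)
    case base
    then show ?case using t by auto
  next
    case (step k)
    have "c k * c (Suc (Suc k)) \<le> c (Suc k) * c (Suc k)"
      using lc[of "Suc k"] step.prems by (simp add: power2_eq_square)
    also have "\<dots> \<le> c k * c (Suc k)"
      using step pos[of "Suc k"] by (intro mult_right_mono) auto
    finally show ?case using pos[of k] step.prems by simp
  qed
  have "c k \<le> c (k - 1)" if "k \<in> {t+1..d}" for k
    using down[of "k - 1"] that by auto
  then have "\<exists>t\<in>{0..d}. (\<forall>k\<in>{1..t}. c (k - 1) \<le> c k) \<and> (\<forall>k\<in>{t+1..d}. c (k - 1) \<ge> c k)"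
    using td up by (intro bexI[of _ t]) auto
  then show ?thesis
    using assms by (auto simp: unimodal_iff log_concave_def c_def d_def)
qed

section \<open>Sign changes of real lists\<close>

text \<open>Isolates the sign condition of the theorem for arbitrary lists, so that it can be
  characterized by induction.\<close>

definition at_most_one_descent :: "real list \<Rightarrow> bool" where
  "at_most_one_descent xs \<longleftrightarrow> length (sign_changes xs) \<le> 1 \<and>
     (\<forall>(x, y)\<in>set (sign_changes xs). x > 0 \<and> y < 0)"

text \<open>With the three rules below, this replaces filtering and zipping by a recursion on the
  first two entries.\<close>

lemma sign_changes_Cons_0: "sign_changes (0 # xs) = sign_changes xs"
  by (simp add: sign_changes_def)

lemma sign_changes_Cons_Cons_0: "sign_changes (x # 0 # xs) = sign_changes (x # xs)"
  by (simp add: sign_changes_def)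

lemma sign_changes_singleton: "sign_changes [x] = []"
  by (simp add: sign_changes_def)

lemma sign_changes_Cons_Cons:
  "x \<noteq> 0 \<Longrightarrow> y \<noteq> 0 \<Longrightarrow> sign_changes (x # y # xs) =
     (if sgn x \<noteq> sgn y then (x, y) # sign_changes (y # xs) else sign_changes (y # xs))"
  by (simp add: sign_changes_def)

lemmas sign_changes_simps =
  sign_changes_Cons_0 sign_changes_Cons_Cons_0 sign_changes_singleton sign_changes_Cons_Cons

lemma sign_changes_neg_Cons:
  assumes "x < 0"
  shows "sign_changes (x # xs) = [] \<longleftrightarrow> (\<forall>y\<in>set xs. y \<le> 0)"
  using assms
proof (induction xs arbitrary: x)
  case (Cons y xs)
  then show ?case
    by (cases y "0 :: real" rule: linorder_cases) (auto simp: sign_changes_simps)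
qed (simp add: sign_changes_simps)

text \<open>The first sign change after a negative head would go from - to +, the forbidden
  direction, so there can be none.\<close>

lemma at_most_one_descent_neg_Cons:
  assumes "x < 0"
  shows "at_most_one_descent (x # xs) \<longleftrightarrow> (\<forall>y\<in>set xs. y \<le> 0)"
  using assms
proof (induction xs arbitrary: x)
  case (Cons y xs)
  then show ?case
    by (cases y "0 :: real" rule: linorder_cases)
       (auto simp: sign_changes_simps at_most_one_descent_def)
qed (simp add: sign_changes_simps at_most_one_descent_def)

text \<open>A positive head adds a sign change only if the next nonzero entry is negative. That
  change is allowed but must be the only one, and for a list with negative head having no sign
  change is the same as \<open>at_most_one_descent\<close>.\<close>

lemma at_most_one_descent_pos_Cons:
  assumes "x > 0"
  shows "at_most_one_descent (x # xs) \<longleftrightarrow> at_most_one_descent xs"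
proof (induction xs)
  case Nil
  then show ?case by (simp add: sign_changes_def at_most_one_descent_def)
next
  case (Cons y xs)
  consider "y = 0" | "y > 0" | "y < 0" by linarith
  then show ?case
  proof cases
    case 3
    then show ?thesis
      using assms sign_changes_neg_Cons[OF 3, of xs] at_most_one_descent_neg_Cons[OF 3, of xs]
      by (auto simp: sign_changes_simps at_most_one_descent_def)
  qed (use Cons assms in \<open>auto simp: sign_changes_simps at_most_one_descent_def\<close>)
qed

text \<open>By induction on the list: a nonnegative head can join the first block, while a negative
  head forces that block to be empty. Zeros fit into either block.\<close>

lemma at_most_one_descent_iff_append:
  "at_most_one_descent xs \<longleftrightarrow>
     (\<exists>us vs. xs = us @ vs \<and> (\<forall>u\<in>set us. u \<ge> 0) \<and> (\<forall>v\<in>set vs. v \<le> 0))"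
    (is "_ \<longleftrightarrow> ?E xs")
proof (induction xs)
  case Nil
  then show ?case by (simp add: sign_changes_def at_most_one_descent_def)
next
  case (Cons x xs)
  show ?case
  proof (cases "x \<ge> 0")
    case True
    have "at_most_one_descent (x # xs) \<longleftrightarrow> at_most_one_descent xs"
      using True at_most_one_descent_pos_Cons[of x xs]
      by (cases "x = 0") (auto simp: sign_changes_simps at_most_one_descent_def)
    also have "\<dots> \<longleftrightarrow> ?E (x # xs)"
      unfolding Cons.IH
    proof
      assume "?E xs"
      then obtain us vs where "xs = us @ vs" "\<forall>u\<in>set us. u \<ge> 0" "\<forall>v\<in>set vs. v \<le> 0" by blast
      then show "?E (x # xs)"
        using True by (intro exI[of _ "x # us"] exI[of _ vs]) auto
    next
      assume "?E (x # xs)"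
      then obtain us vs where *: "x # xs = us @ vs" "\<forall>u\<in>set us. u \<ge> 0" "\<forall>v\<in>set vs. v \<le> 0" by blast
      show "?E xs"
      proof (cases us)
        \<comment> \<open>The head lies in the second block, and so does all of
          \<open>xs\<close>.\<close>
        case Nil
        then show ?thesis using * by (intro exI[of _ "[]"] exI[of _ xs]) auto
      next
        case (Cons u us')
        then show ?thesis using * by (intro exI[of _ us'] exI[of _ vs]) auto
      qed
    qed
    finally show ?thesis .
  next
    case False
    have "?E (x # xs) \<longleftrightarrow> (\<forall>y\<in>set xs. y \<le> 0)"
    proof
      assume "?E (x # xs)"
      then obtain us vs where *: "x # xs = us @ vs" "\<forall>u\<in>set us. u \<ge> 0" "\<forall>v\<in>set vs. v \<le> 0" by blast
      with False show "\<forall>y\<in>set xs. y \<le> 0" by (cases us) auto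
    next
      assume "\<forall>y\<in>set xs. y \<le> 0"
      with False show "?E (x # xs)" by (intro exI[of _ "[]"] exI[of _ "x # xs"]) auto
    qed
    then show ?thesis using at_most_one_descent_neg_Cons[of x xs] False by simp
  qed
qed

lemma at_most_one_descent_map_iff:
  "at_most_one_descent (map g [1..<d + 1]) \<longleftrightarrow>
     (\<exists>t\<in>{0..d}. (\<forall>k\<in>{1..t}. g k \<ge> 0) \<and> (\<forall>k\<in>{t+1..d}. g k \<le> 0))"
  unfolding at_most_one_descent_iff_append
proof
  assume "\<exists>us vs. map g [1..<d + 1] = us @ vs \<and> (\<forall>u\<in>set us. u \<ge> 0) \<and> (\<forall>v\<in>set vs. v \<le> 0)"
  then obtain us vs where *: "map g [1..<d + 1] = us @ vs"
    "\<forall>u\<in>set us. u \<ge> 0" "\<forall>v\<in>set vs. v \<le> 0" by blast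
  \<comment> \<open>The list of values starts at index 1, so a prefix of length \<open>t\<close>
    ends with \<open>g t\<close>; the length of the first block is the index of the peak.\<close>
  define t where "t = length us"
  have td: "t \<le> d" using arg_cong[OF *(1), of length] by (simp add: t_def del: upt_Suc)
  have "us = take t (map g [1..<d + 1])" "vs = drop t (map g [1..<d + 1])"
    unfolding *(1) by (auto simp: t_def)
  then have "us = map g [1..<t + 1]" "vs = map g [t + 1..<d + 1]"
    using td by (simp_all add: take_map drop_map take_upt del: upt_Suc)
  then show "\<exists>t\<in>{0..d}. (\<forall>k\<in>{1..t}. g k \<ge> 0) \<and> (\<forall>k\<in>{t+1..d}. g k \<le> 0)"
    using td *(2,3) by (intro bexI[of _ t]) (auto simp del: upt_Suc)
next
  assume "\<exists>t\<in>{0..d}. (\<forall>k\<in>{1..t}. g k \<ge> 0) \<and> (\<forall>k\<in>{t+1..d}. g k \<le> 0)"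
  then obtain t where t: "t \<le> d" "\<forall>k\<in>{1..t}. g k \<ge> 0" "\<forall>k\<in>{t+1..d}. g k \<le> 0" by auto
  have "[1..<d + 1] = [1..<t + 1] @ [t + 1..<d + 1]"
    using upt_add_eq_append[of 1 "t + 1" "d - t"] t(1) by simp
  then have "map g [1..<d + 1] = map g [1..<t + 1] @ map g [t + 1..<d + 1]" by simp
  with t show "\<exists>us vs. map g [1..<d + 1] = us @ vs \<and> (\<forall>u\<in>set us. u \<ge> 0) \<and> (\<forall>v\<in>set vs. v \<le> 0)"
    by (intro exI[of _ "map g [1..<t + 1]"] exI[of _ "map g [t + 1..<d + 1]"])
       (auto simp del: upt_Suc)
qed

section \<open>The criteria for \<open>P a b n\<close>\<close>

theorem theorem8p2:
  fixes a b n D s :: nat and nabla :: "nat \<Rightarrow> real"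
  assumes "a \<ge> 1" and "n \<ge> 1" and "b \<ge> 3"
    and "D = max a (2 * n)"
    and "s = min (D - 1) (min a (2 * n) + 1)"
    and "\<And>k. nabla k = p a b n k - p a b n (k - 1)"
  shows
    "degree (P a b n) = D
     \<and> P a b n = (\<Sum>k=0..D. monom (p a b n k) k)
     \<and> pos_coeffs (P a b n)
     \<and> (log_concave (P a b n) \<longleftrightarrow>
          (\<forall>k\<in>{1..s}. (p a b n k)\<^sup>2 \<ge> p a b n (k - 1) * p a b n (k + 1)))
     \<and> (log_concave (P a b n) \<longleftrightarrow>
          (\<forall>k\<in>{1..s}. (real (a choose k) + q b n k)\<^sup>2
             \<ge> (if k = 1 then 1 else real (a choose (k - 1)) + q b n (k - 1))
                 * (real (a choose (k + 1)) + q b n (k + 1))))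
     \<and> (unimodal (P a b n) \<longleftrightarrow>
          (\<exists>t\<in>{0..D}. (\<forall>k\<in>{1..t}. p a b n (k - 1) \<le> p a b n k)
                    \<and> (\<forall>k\<in>{t+1..D}. p a b n (k - 1) \<ge> p a b n k)))
     \<and> (unimodal (P a b n) \<longleftrightarrow>
          length (sign_changes (map nabla [1..<D + 1])) \<le> 1
          \<and> (\<forall>(x, y)\<in>set (sign_changes (map nabla [1..<D + 1])). x > 0 \<and> y < 0))
     \<and> ((\<forall>k\<in>{1..s}. (p a b n k)\<^sup>2 \<ge> p a b n (k - 1) * p a b n (k + 1))
          \<longrightarrow> unimodal (P a b n))"
proof -
  have b: "b \<ge> 2" using assms(3) by simp
  have deg: "degree (P a b n) = D"
    using degree_P[OF b] assms(4) by simp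
  have expand: "P a b n = (\<Sum>k=0..D. monom (p a b n k) k)"
    using poly_as_sum_of_monoms[of "P a b n"] by (simp add: deg coeff_P atLeast0AtMost)
  have pos: "pos_coeffs (P a b n)"
    using p_pos[OF b] by (auto simp: pos_coeffs_def deg coeff_P assms(4))
  have lc: "log_concave (P a b n) \<longleftrightarrow>
      (\<forall>k\<in>{1..s}. (p a b n k)\<^sup>2 \<ge> p a b n (k - 1) * p a b n (k + 1))" (is "_ \<longleftrightarrow> ?lc")
  proof
    assume "log_concave (P a b n)"
    then show ?lc
      using assms(2) by (auto simp: log_concave_def deg coeff_P assms(4,5))
  next
    assume *: ?lc
    have "(p a b n k)\<^sup>2 \<ge> p a b n (k - 1) * p a b n (k + 1)" if "1 \<le> k" "k < D" for k
    proof (cases "k \<le> s")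
      case False
      \<comment> \<open>Since \<open>k \<le> D - 1\<close> but \<open>k > s\<close>, the minimum
        defining \<open>s\<close> is its other argument, \<open>min a (2 * n) + 1\<close>.\<close>
      with that have "k \<ge> min a (2 * n) + 2" by (auto simp: assms(5))
      then show ?thesis by (rule p_log_concave_beyond)
    qed (use * that in auto)
    then show "log_concave (P a b n)"
      using pos by (auto simp: log_concave_def deg coeff_P)
  qed
  have lc_explicit: "?lc \<longleftrightarrow> (\<forall>k\<in>{1..s}. (real (a choose k) + q b n k)\<^sup>2
             \<ge> (if k = 1 then 1 else real (a choose (k - 1)) + q b n (k - 1))
                 * (real (a choose (k + 1)) + q b n (k + 1)))"
    by (intro ball_cong) (auto simp: p_def)
  have uni: "unimodal (P a b n) \<longleftrightarrow>
          (\<exists>t\<in>{0..D}. (\<forall>k\<in>{1..t}. p a b n (k - 1) \<le> p a b n k)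
                    \<and> (\<forall>k\<in>{t+1..D}. p a b n (k - 1) \<ge> p a b n k))"
    using pos by (simp add: unimodal_iff deg coeff_P)
  \<comment> \<open>Rising and falling steps are nonnegative and nonpositive values of
    \<open>nabla\<close>; the peak index is the point where the list splits.\<close>
  also have "\<dots> \<longleftrightarrow> at_most_one_descent (map nabla [1..<D + 1])"
    unfolding at_most_one_descent_map_iff assms(6) by simp
  finally have signs: "unimodal (P a b n) \<longleftrightarrow>
          length (sign_changes (map nabla [1..<D + 1])) \<le> 1
          \<and> (\<forall>(x, y)\<in>set (sign_changes (map nabla [1..<D + 1])). x > 0 \<and> y < 0)"
    unfolding at_most_one_descent_def .
  have "?lc \<longrightarrow> unimodal (P a b n)"
    using lc log_concave_imp_unimodal by blast
  with deg expand pos lc lc[unfolded lc_explicit] uni signs show ?thesis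
    by (intro conjI)
qed

end
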